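(* Algebraic probability distributions on $\mathbb{R}$ form a semi-group under free additive convolution $\boxplus$; that is, if $F^A$ and $F^B$ are algebraic probability distributions, then so is $F^A\boxplus F^B$.
   Context: The Stieltjes transform of a probability distribution function $F$ on $\mathbb{R}$ is $m(z)=\int\frac{1}{x-z}\,dF(x)$ for $z\in\mathbb{C}^+$ (the open upper half plane). $F$ is algebraic if there is a nonzero bivariate polynomial $L(m,z)$ with real coefficients such that $L(m(z),z)=0$ for all $z\in\mathbb{C}^+$. Free additive convolution: let $g(z)=-m(z)$ be the Cauchy transform of $F$. It is invertible under composition on a suitable truncated angular domain near $i\infty$ in $\mathbb{C}^+$, and the R transform is $r(g)=z(g)-\frac1g$, where $z(\cdot)=g^{\langle-1\rangle}(\cdot)$ is this inverse. For probability distributions $F^A,F^B$ on $\mathbb{R}$ (no moment or support assumption), $F^A\boxplus F^B$ is the unique probability distribution whose R transform equals $r_A+r_B$ on a common domain of definition. *)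

theory Defs
  imports "HOL-Probability.Probability" "HOL-Computational_Algebra.Polynomial"
begin

text \<open>
  Probability distributions on the real line are represented by their Borel probability measures
  (locale \<^locale>\<open>real_distribution\<close>); integration against the measure is integration
  against its distribution function \<^term>\<open>cdf M\<close>.
\<close>

definition stieltjes_transform :: "real measure \<Rightarrow> complex \<Rightarrow> complex" where
  "stieltjes_transform M z = (LINT x|M. 1 / (complex_of_real x - z))"

definition cauchy_transform :: "real measure \<Rightarrow> complex \<Rightarrow> complex" where
  "cauchy_transform M z = - stieltjes_transform M z"

text \<open>
  A bivariate polynomial \<open>L(m, z)\<close> with real coefficients is a polynomial in \<open>m\<close> whose
  coefficients are polynomials in \<open>z\<close>.
\<close>

definition eval_bipoly :: "real poly poly \<Rightarrow> complex \<Rightarrow> complex \<Rightarrow> complex" where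
  "eval_bipoly L m z = poly (map_poly (\<lambda>c. poly (map_poly complex_of_real c) z) L) m"

definition algebraic_distribution :: "real measure \<Rightarrow> bool" where
  "algebraic_distribution M \<longleftrightarrow> real_distribution M \<and>
     (\<exists>L. L \<noteq> 0 \<and> (\<forall>z. Im z > 0 \<longrightarrow> eval_bipoly L (stieltjes_transform M z) z = 0))"

text \<open>
  The truncated angular domains at \<open>i\<infinity>\<close> in the upper half plane. Since \<open>g(z) \<sim> 1/z\<close> there,
  \<open>R\<close> transforms live on their images under \<open>z \<mapsto> 1/z\<close>.
\<close>

definition truncated_angle :: "real \<Rightarrow> real \<Rightarrow> complex set" where
  "truncated_angle \<alpha> \<beta> = {z. \<bar>Re z\<bar> < \<alpha> * Im z \<and> Im z > \<beta>}"

text \<open>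
  \<open>r\<close> is the \<open>R\<close> transform of \<open>M\<close> on \<open>D\<close>: the Cauchy transform is invertible on some truncated
  angular domain, its inverse is defined on \<open>D\<close>, and \<open>r(g) = z(g) - 1/g\<close> there. If \<open>D\<close> is
  the image of a truncated angular domain under \<open>z \<mapsto> 1/z\<close>, the values of \<open>r\<close> on \<open>D\<close> do not depend
  on the choice of \<open>\<alpha>\<close> and \<open>\<beta>\<close>: two inverses of \<open>g\<close> agree near \<open>0\<close>, hence on the connected set \<open>D\<close>.
\<close>

definition is_R_transform_on :: "complex set \<Rightarrow> real measure \<Rightarrow> (complex \<Rightarrow> complex) \<Rightarrow> bool" where
  "is_R_transform_on D M r \<longleftrightarrow>
     (\<exists>\<alpha>>0. \<exists>\<beta>>0. inj_on (cauchy_transform M) (truncated_angle \<alpha> \<beta>) \<and>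
        D \<subseteq> cauchy_transform M ` truncated_angle \<alpha> \<beta> \<and>
        (\<forall>g\<in>D. r g = the_inv_into (truncated_angle \<alpha> \<beta>) (cauchy_transform M) g - 1 / g))"

text \<open>
  \<open>C\<close> is the free additive convolution of \<open>A\<close> and \<open>B\<close>. By the theorem of Bercovici and Voiculescu
  there is exactly one such \<open>C\<close> for all probability distributions \<open>A\<close> and \<open>B\<close>.
\<close>

definition is_free_additive_convolution ::
    "real measure \<Rightarrow> real measure \<Rightarrow> real measure \<Rightarrow> bool" where
  "is_free_additive_convolution A B C \<longleftrightarrow>
     real_distribution A \<and> real_distribution B \<and> real_distribution C \<and>
     (\<exists>a>0. \<exists>b>0. \<exists>r\<^sub>A r\<^sub>B.
        let D = inverse ` truncated_angle a b in
          is_R_transform_on D A r\<^sub>A \<and> is_R_transform_on D B r\<^sub>B \<and>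
          is_R_transform_on D C (\<lambda>g. r\<^sub>A g + r\<^sub>B g))"

end

theory Submission
  imports Defs "HOL-Complex_Analysis.Complex_Analysis"
begin

text \<open>
  Write \<open>m = -g\<close>, and let \<open>z\<^sub>A\<close>, \<open>z\<^sub>B\<close>, \<open>z\<^sub>C\<close> be the inverses of the Cauchy transforms.
  Additivity of the \<open>R\<close> transform reads \<open>z\<^sub>C = z\<^sub>A + z\<^sub>B + 1/m\<close>. All three summands are
  algebraic over \<open>\<real>[m]\<close>, hence so is \<open>z\<^sub>C\<close>. This gives a polynomial relation between \<open>m\<close> and
  \<open>z\<close> on a nonempty open part of the graph of the Stieltjes transform of \<open>C\<close>, which extends to the
  whole upper half plane by analytic continuation.
\<close>

section \<open>Sums of algebraic elements\<close>

lemma poly_eq_sum_atMost: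
  fixes p :: "'a::comm_semiring_1 poly"
  assumes "degree p \<le> n"
  shows "poly p x = (\<Sum>i\<le>n. coeff p i * x ^ i)"
  unfolding poly_altdef by (rule sum.mono_neutral_left) (use assms in \<open>auto simp: coeff_eq_0\<close>)

text \<open>Fraction-free Gaussian elimination, by induction on the equations: a pivot
  \<open>c k0 i\<close> eliminates the unknown \<open>k0\<close>, and cross-multiplication replaces
  division, which an integral domain lacks.\<close>

lemma homogeneous_system_nontrivial_solution:
  fixes c :: "'k \<Rightarrow> 'i \<Rightarrow> 'a::idom"
  assumes "finite I" "finite K" "card I < card K"
  shows "\<exists>p. (\<exists>k\<in>K. p k \<noteq> 0) \<and> (\<forall>i\<in>I. (\<Sum>k\<in>K. p k * c k i) = 0)"
  using assms
proof (induction I arbitrary: K c rule: finite_induct)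
  case empty
  then have "K \<noteq> {}" by auto
  then show ?case by (intro exI[of _ "\<lambda>_. 1"]) auto
next
  case (insert i I)
  show ?case
  proof (cases "\<forall>k\<in>K. c k i = 0")
    case True
    have "card I < card K" using insert by simp
    from insert.IH[OF insert.prems(1) this, of c] True show ?thesis by auto
  next
    case False
    then obtain k0 where k0: "k0 \<in> K" "c k0 i \<noteq> 0" by auto
    define K' where "K' = K - {k0}"
    have K': "finite K'" "card I < card K'" "k0 \<notin> K'" "K = insert k0 K'"
      using insert k0 by (auto simp: K'_def)
    define c' where "c' k j = c k0 i * c k j - c k i * c k0 j" for k j
    obtain p' where p': "\<exists>k\<in>K'. p' k \<noteq> 0" "\<And>j. j \<in> I \<Longrightarrow> (\<Sum>k\<in>K'. p' k * c' k j) = 0"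
      using insert.IH[OF K'(1,2), of c'] by auto
    \<comment> \<open>Equation \<open>i\<close> dictates \<open>p k0\<close>; scaling the other
      unknowns by the pivot clears its denominator. In equation \<open>i\<close> itself every
      \<open>c' k i\<close> is 0.\<close>
    define p where
      "p k = (if k = k0 then - (\<Sum>k\<in>K'. p' k * c k i) else p' k * c k0 i)" for k
    have sum_p: "(\<Sum>k\<in>K. p k * c k j) = (\<Sum>k\<in>K'. p' k * c' k j)" for j
    proof -
      have "(\<Sum>k\<in>K. p k * c k j) = p k0 * c k0 j + (\<Sum>k\<in>K'. p k * c k j)"
        unfolding K'(4) using K'(1,3) by simp
      also have "(\<Sum>k\<in>K'. p k * c k j) = (\<Sum>k\<in>K'. p' k * c k0 i * c k j)"
        using K'(3) by (intro sum.cong) (auto simp: p_def)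
      also have "p k0 * c k0 j = - (\<Sum>k\<in>K'. p' k * c k i * c k0 j)"
        by (simp add: p_def sum_distrib_right)
      finally show ?thesis
        by (simp add: c'_def right_diff_distrib sum_subtractf mult.assoc)
    qed
    have "\<forall>j\<in>insert i I. (\<Sum>k\<in>K. p k * c k j) = 0"
      using p'(2) by (auto simp: sum_p) (simp add: c'_def mult.commute)
    moreover have "\<exists>k\<in>K. p k \<noteq> 0"
      using p'(1) k0 K'(3,4) by (auto simp: p_def)
    ultimately show ?thesis by blast
  qed
qed

text \<open>Algebraicity is treated pointwise: each \<open>h t\<close> is a ring homomorphism, and
  together they are injective. Functions on \<open>T\<close> need not form an integral domain, but
  \<open>'a\<close> and \<open>'b\<close> do.\<close>

locale evaluations =
  fixes T :: "'t set" and h :: "'t \<Rightarrow> 'a::idom \<Rightarrow> 'b::idom"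
  assumes h_0 [simp]: "t \<in> T \<Longrightarrow> h t 0 = 0"
    and h_1 [simp]: "t \<in> T \<Longrightarrow> h t 1 = 1"
    and h_add [simp]: "t \<in> T \<Longrightarrow> h t (p + q) = h t p + h t q"
    and h_mult [simp]: "t \<in> T \<Longrightarrow> h t (p * q) = h t p * h t q"
    and h_separates_0: "p \<noteq> 0 \<Longrightarrow> \<exists>t\<in>T. h t p \<noteq> 0"
begin

lemma h_minus [simp]: "t \<in> T \<Longrightarrow> h t (- p) = - h t p"
  using h_add[of t p "-p"] h_0[of t] by (simp add: eq_neg_iff_add_eq_0 add.commute del: h_add)

lemma h_sum [simp]: "t \<in> T \<Longrightarrow> h t (sum f A) = (\<Sum>a\<in>A. h t (f a))"
  by (induction A rule: infinite_finite_induct) auto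

lemma h_power [simp]: "t \<in> T \<Longrightarrow> h t (p ^ n) = h t p ^ n"
  by (induction n) auto

lemma poly_map_poly_h:
  assumes "t \<in> T" "degree P \<le> n"
  shows "poly (map_poly (h t) P) x = (\<Sum>i\<le>n. h t (coeff P i) * x ^ i)"
proof -
  have "degree (map_poly (h t) P) \<le> n"
    using assms by (intro degree_le) (auto simp: coeff_map_poly coeff_eq_0)
  then show ?thesis
    using assms by (simp add: poly_eq_sum_atMost coeff_map_poly)
qed

text \<open>One \<open>P\<close> serves all \<open>t\<close>. It may become the zero polynomial at
  individual points, where the condition is void, but by \<open>h_separates_0\<close> not on all of
  \<open>T\<close>.\<close>

definition algebraic_on :: "('t \<Rightarrow> 'b) \<Rightarrow> bool" where
  "algebraic_on x \<longleftrightarrow> (\<exists>P. P \<noteq> 0 \<and> (\<forall>t\<in>T. poly (map_poly (h t) P) (x t) = 0))"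

text \<open>The coefficients \<open>c\<close> do not vary with \<open>t\<close>, so that they can
  enter a linear system over \<open>'a\<close>.\<close>

definition spanned :: "('t \<Rightarrow> 'b) \<Rightarrow> ('t \<Rightarrow> 'b) \<Rightarrow> nat \<Rightarrow> nat \<Rightarrow> ('t \<Rightarrow> 'b) \<Rightarrow> bool" where
  "spanned x y m n f \<longleftrightarrow>
     (\<exists>c. \<forall>t\<in>T. f t = (\<Sum>i<m. \<Sum>j<n. h t (c i j) * (x t ^ i * y t ^ j)))"

lemma spanned_cong: "(\<And>t. t \<in> T \<Longrightarrow> f t = g t) \<Longrightarrow> spanned x y m n f = spanned x y m n g"
  by (auto simp: spanned_def)

lemma spanned_swap: "spanned x y m n f \<Longrightarrow> spanned y x n m f"
  unfolding spanned_def
proof (elim exE)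
  fix c assume c: "\<forall>t\<in>T. f t = (\<Sum>i<m. \<Sum>j<n. h t (c i j) * (x t ^ i * y t ^ j))"
  show "\<exists>c. \<forall>t\<in>T. f t = (\<Sum>i<n. \<Sum>j<m. h t (c i j) * (y t ^ i * x t ^ j))"
    by (rule exI[of _ "\<lambda>i j. c j i"], subst sum.swap) (use c in \<open>simp add: mult.commute\<close>)
qed

lemma spanned_monomial:
  assumes "i < m" "j < n"
  shows "spanned x y m n (\<lambda>t. x t ^ i * y t ^ j)"
  unfolding spanned_def
proof (intro exI ballI)
  fix t assume t: "t \<in> T"
  have "(\<Sum>j'<n. h t (if i' = i \<and> j' = j then 1 else 0) * (x t ^ i' * y t ^ j'))
      = (if i' = i then x t ^ i * y t ^ j else 0)" for i'
  proof (cases "i' = i")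
    case True
    then have "(\<Sum>j'<n. h t (if i' = i \<and> j' = j then 1 else 0) * (x t ^ i' * y t ^ j'))
        = (\<Sum>j'<n. if j' = j then x t ^ i * y t ^ j else 0)"
      using t by (intro sum.cong) auto
    then show ?thesis using True assms by simp
  qed (use t in simp)
  then show "x t ^ i * y t ^ j =
      (\<Sum>i'<m. \<Sum>j'<n. h t (if i' = i \<and> j' = j then 1 else 0) * (x t ^ i' * y t ^ j'))"
    using assms by simp
qed

lemma spanned_scale: "spanned x y m n f \<Longrightarrow> spanned x y m n (\<lambda>t. h t p * f t)"
  unfolding spanned_def
proof (elim exE)
  fix c assume c: "\<forall>t\<in>T. f t = (\<Sum>i<m. \<Sum>j<n. h t (c i j) * (x t ^ i * y t ^ j))"
  show "\<exists>c. \<forall>t\<in>T. h t p * f t = (\<Sum>i<m. \<Sum>j<n. h t (c i j) * (x t ^ i * y t ^ j))"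
    by (rule exI[of _ "\<lambda>i j. p * c i j"]) (use c in \<open>simp add: sum_distrib_left mult_ac\<close>)
qed

lemma spanned_0: "spanned x y m n (\<lambda>t. 0)"
  unfolding spanned_def by (rule exI[of _ "\<lambda>i j. 0"]) simp

lemma spanned_add:
  assumes "spanned x y m n f" "spanned x y m n g"
  shows "spanned x y m n (\<lambda>t. f t + g t)"
proof -
  obtain c d where c: "\<forall>t\<in>T. f t = (\<Sum>i<m. \<Sum>j<n. h t (c i j) * (x t ^ i * y t ^ j))"
    and d: "\<forall>t\<in>T. g t = (\<Sum>i<m. \<Sum>j<n. h t (d i j) * (x t ^ i * y t ^ j))"
    using assms unfolding spanned_def by blast
  show ?thesis
    unfolding spanned_def
    by (rule exI[of _ "\<lambda>i j. c i j + d i j"]) (use c d in \<open>simp add: sum.distrib distrib_right\<close>)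
qed

lemma spanned_sum:
  "(\<And>k. k \<in> A \<Longrightarrow> spanned x y m n (f k)) \<Longrightarrow> spanned x y m n (\<lambda>t. \<Sum>k\<in>A. f k t)"
  by (induction A rule: infinite_finite_induct) (auto intro: spanned_0 spanned_add)

text \<open>Multiplication by \<open>x\<close> shifts exponents, and only the overflow
  \<open>x ^ degree P\<close> must be reduced. The relation \<open>P\<close> does this once the
  overflow carries the factor \<open>lead_coeff P\<close>.\<close>

lemma spanned_mult_left:
  assumes root: "\<And>t. t \<in> T \<Longrightarrow> poly (map_poly (h t) P) (x t) = 0"
    and f: "spanned x y (degree P) n f"
  shows "spanned x y (degree P) n (\<lambda>t. h t (lead_coeff P) * x t * f t)"
proof -
  define m where "m = degree P"
  define a where "a = lead_coeff P"
  have lead: "h t a * x t ^ m = (\<Sum>i<m. h t (- coeff P i) * x t ^ i)" if "t \<in> T" for t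
    using root[OF that] poly_map_poly_h[OF that, of P m "x t"] that
    by (simp add: m_def a_def sum_negf eq_neg_iff_add_eq_0 add.commute flip: lessThan_Suc_atMost)
  have mono: "spanned x y m n (\<lambda>t. h t a * x t ^ Suc i * y t ^ j)" if "i < m" "j < n" for i j
  proof (cases "Suc i < m")
    case True
    show ?thesis
      using spanned_scale[OF spanned_monomial[OF True that(2), of x y], of a]
      by (simp add: mult.assoc)
  next
    case False
    then have "Suc i = m" using that by simp
    then have "h t a * x t ^ Suc i * y t ^ j
        = (\<Sum>i<m. h t (- coeff P i) * (x t ^ i * y t ^ j))" if "t \<in> T" for t
      using lead[OF that] by (simp add: sum_distrib_right mult.assoc)
    then show ?thesis
      using that
      by (subst spanned_cong) (auto intro!: spanned_sum spanned_scale spanned_monomial simp del: h_minus)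
  qed
  obtain c where c: "\<And>t. t \<in> T \<Longrightarrow>
      f t = (\<Sum>i<m. \<Sum>j<n. h t (c i j) * (x t ^ i * y t ^ j))"
    using f unfolding spanned_def m_def by blast
  have "h t a * x t * f t = (\<Sum>i<m. \<Sum>j<n. h t (c i j) * (h t a * x t ^ Suc i * y t ^ j))"
    if "t \<in> T" for t
    unfolding c[OF that] sum_distrib_left by (simp add: mult_ac)
  then have "spanned x y m n (\<lambda>t. h t a * x t * f t)"
    by (subst spanned_cong) (auto intro!: spanned_sum spanned_scale mono simp del: power_Suc)
  then show ?thesis by (simp add: m_def a_def)
qed

text \<open>A constant relation would have a nonzero coefficient that vanishes at every
  \<open>t\<close>, against separation. Positive degrees put the monomial 1 into the span, which
  starts the induction on powers below.\<close>

lemma degree_pos: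
  assumes "P \<noteq> 0" "\<And>t. t \<in> T \<Longrightarrow> poly (map_poly (h t) P) (x t) = 0"
  shows "degree P > 0"
proof (rule ccontr)
  assume "\<not> degree P > 0"
  then obtain p where p: "P = [:p:]" using degree_eq_zeroE by blast
  then obtain t where "t \<in> T" "h t p \<noteq> 0" using assms(1) h_separates_0[of p] by auto
  then show False using assms(2)[of t] poly_map_poly_h[of t P 0 "x t"] p by simp
qed

text \<open>
  With \<open>a\<close>, \<open>b\<close> the leading coefficients, each power of \<open>a b (x + y)\<close> lies in the span of the \<open>m n\<close>
  monomials \<open>x\<^sup>i y\<^sup>j\<close>, so \<open>m n + 1\<close> of them are linearly dependent. Scaling by
  \<open>a b\<close> instead of dividing keeps the relation valid at the points where \<open>a\<close> or \<open>b\<close> vanishes.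
\<close>

lemma algebraic_on_add:
  assumes "algebraic_on x" "algebraic_on y"
  shows "algebraic_on (\<lambda>t. x t + y t)"
proof -
  obtain P Q where PQ: "P \<noteq> 0" "Q \<noteq> 0"
    and P: "\<And>t. t \<in> T \<Longrightarrow> poly (map_poly (h t) P) (x t) = 0"
    and Q: "\<And>t. t \<in> T \<Longrightarrow> poly (map_poly (h t) Q) (y t) = 0"
    using assms unfolding algebraic_on_def by blast
  define m n a b where "m = degree P" and "n = degree Q"
    and "a = lead_coeff P" and "b = lead_coeff Q"
  have mn: "m > 0" "n > 0"
    using degree_pos[OF PQ(1) P] degree_pos[OF PQ(2) Q] by (auto simp: m_def n_def)
  have ab: "a * b \<noteq> 0" using PQ by (simp add: a_def b_def)
  have "spanned x y m n (\<lambda>t. (h t (a * b) * (x t + y t)) ^ k)" for k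
  proof (induction k)
    case 0
    then show ?case using spanned_monomial[OF mn, of x y] by simp
  next
    case (Suc k)
    let ?f = "\<lambda>t. (h t (a * b) * (x t + y t)) ^ k"
    have 1: "spanned x y m n (\<lambda>t. h t a * x t * ?f t)"
      unfolding m_def a_def by (rule spanned_mult_left[OF P]) (use Suc in \<open>simp_all add: m_def a_def\<close>)
    have 2: "spanned x y m n (\<lambda>t. h t b * y t * ?f t)"
      unfolding n_def b_def
      by (rule spanned_swap, rule spanned_mult_left[OF Q])
        (use spanned_swap[OF Suc] in \<open>simp_all add: n_def b_def\<close>)
    have "(h t (a * b) * (x t + y t)) ^ Suc k =
        h t b * (h t a * x t * ?f t) + h t a * (h t b * y t * ?f t)" if "t \<in> T" for t
      using that by (simp add: algebra_simps)
    then show ?case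
      using spanned_add[OF spanned_scale[OF 1, of b] spanned_scale[OF 2, of a]]
      by (subst spanned_cong) auto
  qed
  then have "\<forall>k. \<exists>c. \<forall>t\<in>T. (h t (a * b) * (x t + y t)) ^ k =
      (\<Sum>i<m. \<Sum>j<n. h t (c i j) * (x t ^ i * y t ^ j))"
    unfolding spanned_def by (rule allI)
  from choice[OF this] obtain c where c: "\<And>k t. t \<in> T \<Longrightarrow> (h t (a * b) * (x t + y t)) ^ k =
      (\<Sum>i<m. \<Sum>j<n. h t (c k i j) * (x t ^ i * y t ^ j))"
    by (elim exE) simp
  \<comment> \<open>One equation for each of the \<open>m * n\<close> monomials, against
    \<open>m * n + 1\<close> unknowns, since \<open>k = 0\<close> counts.\<close>
  obtain p where p: "\<exists>k\<in>{..m*n}. p k \<noteq> 0"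
    "\<And>i j. i < m \<Longrightarrow> j < n \<Longrightarrow> (\<Sum>k\<le>m*n. p k * c k i j) = 0"
    using homogeneous_system_nontrivial_solution
      [of "{..<m} \<times> {..<n}" "{..m*n}" "\<lambda>k (i, j). c k i j"] by auto
  \<comment> \<open>The dependence among the powers, read as a polynomial in x + y:
    \<open>(a * b) ^ k\<close> moves into the coefficient, which stays nonzero wherever
    \<open>p k\<close> is.\<close>
  define L where "L = (\<Sum>k\<le>m*n. monom (p k * (a * b) ^ k) k)"
  have coeff_L: "coeff L k = p k * (a * b) ^ k" if "k \<le> m * n" for k
    using that by (simp add: L_def coeff_sum)
  have "degree L \<le> m * n"
    unfolding L_def by (intro degree_sum_le) (auto intro: order.trans[OF degree_monom_le])
  then have "poly (map_poly (h t) L) (x t + y t) = 0" if t: "t \<in> T" for t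
  proof -
    have "poly (map_poly (h t) L) (x t + y t)
        = (\<Sum>k\<le>m*n. h t (p k) * (h t (a * b) * (x t + y t)) ^ k)"
      unfolding poly_map_poly_h[OF t \<open>degree L \<le> m * n\<close>]
      using t by (intro sum.cong) (simp_all add: coeff_L power_mult_distrib mult.assoc)
    also have "\<dots> = (\<Sum>k\<le>m*n. \<Sum>i<m. \<Sum>j<n. h t (p k * c k i j) * (x t ^ i * y t ^ j))"
      unfolding c[OF t] using t by (simp add: sum_distrib_left mult.assoc)
    also have "\<dots> = (\<Sum>i<m. \<Sum>k\<le>m*n. \<Sum>j<n. h t (p k * c k i j) * (x t ^ i * y t ^ j))"
      by (rule sum.swap)
    also have "\<dots> = (\<Sum>i<m. \<Sum>j<n. \<Sum>k\<le>m*n. h t (p k * c k i j) * (x t ^ i * y t ^ j))"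
      by (intro sum.cong refl sum.swap)
    also have "\<dots> = (\<Sum>i<m. \<Sum>j<n. h t (\<Sum>k\<le>m*n. p k * c k i j) * (x t ^ i * y t ^ j))"
      using t by (simp only: h_sum sum_distrib_right)
    also have "\<dots> = 0"
      using t p(2) by (intro sum.neutral ballI) (simp del: h_sum)
    finally show ?thesis .
  qed
  moreover have "L \<noteq> 0"
    using p(1) coeff_L ab by fastforce
  ultimately show ?thesis unfolding algebraic_on_def by blast
qed

end

section \<open>Bivariate polynomials\<close>

lemma poly_map_poly_of_real_pCons:
  "poly (map_poly of_real (pCons a p)) (z::complex) = of_real a + z * poly (map_poly of_real p) z"
  by (simp add: map_poly_pCons)

lemma poly_map_poly_of_real_add:
  "poly (map_poly of_real (p + q)) (z::complex)
    = poly (map_poly of_real p) z + poly (map_poly of_real q) z"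
proof -
  have "map_poly complex_of_real (p + q) = map_poly of_real p + map_poly of_real q"
    by (rule poly_eqI) (simp add: coeff_map_poly)
  then show ?thesis by simp
qed

lemma poly_map_poly_of_real_mult:
  "poly (map_poly of_real (p * q)) (z::complex)
    = poly (map_poly of_real p) z * poly (map_poly of_real q) z"
proof (induction p)
  case (pCons a p)
  have "map_poly complex_of_real (smult a q) = smult (of_real a) (map_poly of_real q)"
    by (rule poly_eqI) (simp add: coeff_map_poly)
  then show ?case
    using pCons by (simp add: poly_map_poly_of_real_add poly_map_poly_of_real_pCons
        algebra_simps)
qed simp

text \<open>A nonzero polynomial has finitely many roots, so an infinite set contains a point that
  detects it.\<close>

lemma evaluations_of_real_poly:
  fixes D :: "complex set"
  assumes "infinite D"
  shows "evaluations D (\<lambda>m p. poly (map_poly complex_of_real p) m)"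
proof
  fix p :: "real poly"
  assume "p \<noteq> 0"
  then have "map_poly complex_of_real p \<noteq> 0" by (simp add: map_poly_eq_0_iff)
  then have "finite {m. poly (map_poly complex_of_real p) m = 0}" by (rule poly_roots_finite)
  with assms show "\<exists>m\<in>D. poly (map_poly complex_of_real p) m \<noteq> 0"
    by (meson finite_subset mem_Collect_eq subsetI)
qed (simp_all add: poly_map_poly_of_real_add poly_map_poly_of_real_mult)

text \<open>A common bound on the inner degrees makes the index range a rectangle, so that the two
  sums can be exchanged.\<close>

lemma eval_bipoly_sum:
  assumes "degree L \<le> n" "\<And>i. degree (coeff L i) \<le> k"
  shows "eval_bipoly L m z
    = (\<Sum>i\<le>n. \<Sum>j\<le>k. of_real (coeff (coeff L i) j) * (m ^ i * z ^ j))"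
proof -
  have "degree (map_poly (\<lambda>c. poly (map_poly complex_of_real c) z) L) \<le> n"
    using assms(1) by (intro degree_le) (auto simp: coeff_map_poly coeff_eq_0)
  moreover have "degree (map_poly complex_of_real (coeff L i)) \<le> k" for i
    using assms(2)[of i] by (intro degree_le) (auto simp: coeff_map_poly coeff_eq_0)
  ultimately show ?thesis
    unfolding eval_bipoly_def
    by (simp add: poly_eq_sum_atMost[of _ n] poly_eq_sum_atMost[of _ k] coeff_map_poly sum_distrib_left sum_distrib_right mult_ac)
qed

lemma bounded_degree_coeffs:
  fixes L :: "'a::comm_monoid_add poly poly"
  obtains k where "\<And>i. degree (coeff L i) \<le> k"
proof
  fix i
  show "degree (coeff L i) \<le> (\<Sum>i\<le>degree L. degree (coeff L i))"
    by (cases "i \<le> degree L") (auto intro: member_le_sum simp: coeff_eq_0)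
qed

text \<open>Transposition of the coefficient matrix: a polynomial in m over \<real>[z] becomes one
  in z over \<real>[m].\<close>

lemma eval_bipoly_swap:
  assumes "L \<noteq> 0"
  obtains K where "K \<noteq> 0" "\<And>m z. eval_bipoly K z m = eval_bipoly L m z"
proof -
  define n where "n = degree L"
  obtain k where k: "\<And>i. degree (coeff L i) \<le> k" using bounded_degree_coeffs by blast
  define K where "K = (\<Sum>j\<le>k. monom (\<Sum>i\<le>n. monom (coeff (coeff L i) j) i) j)"
  have coeff_K: "coeff (coeff K j) i = coeff (coeff L i) j" for i j
  proof -
    have "coeff L i = 0" if "i > n" using that by (simp add: n_def coeff_eq_0)
    moreover have "coeff (coeff L i) j = 0" if "j > k"
      using that k[of i] by (intro coeff_eq_0) simp
    ultimately show ?thesis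
      by (auto simp: K_def coeff_sum not_le)
  qed
  have "degree K \<le> k"
    unfolding K_def by (intro degree_sum_le) (auto intro: order.trans[OF degree_monom_le])
  moreover have "degree (coeff K j) \<le> n" for j
    by (intro degree_le) (auto simp: coeff_K n_def coeff_eq_0)
  ultimately have "eval_bipoly K z m = eval_bipoly L m z" for m z
    using k by (simp add: eval_bipoly_sum[of _ k n] eval_bipoly_sum[of _ n k] n_def coeff_K)
      (subst sum.swap, simp add: mult.commute)
  moreover have "K \<noteq> 0"
  proof
    assume "K = 0"
    then have "coeff (coeff L i) j = 0" for i j using coeff_K[of j i] by simp
    then have "L = 0" by (intro poly_eqI) simp
    with assms show False by simp
  qed
  ultimately show ?thesis using that by blast
qed

section \<open>The Stieltjes transform is holomorphic\<close>

lemma Im_le_norm_of_real_diff: "Im z \<le> norm (of_real x - z)"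
  using abs_Im_le_cmod[of "of_real x - z"] by simp

text \<open>Since |x - z| \<ge> Im z > 0, the integrand is bounded, and the measure is
  finite.\<close>

lemma (in real_distribution) integrable_resolvent_power:
  assumes "Im z > 0"
  shows "integrable M (\<lambda>x. 1 / (of_real x - z) ^ n)"
proof (rule integrable_const_bound[where B = "1 / Im z ^ n"])
  show "AE x in M. norm (1 / (of_real x - z) ^ n) \<le> 1 / Im z ^ n"
  proof (intro AE_I2)
    fix x :: real
    have "Im z ^ n \<le> norm (of_real x - z) ^ n"
      using assms Im_le_norm_of_real_diff by (intro power_mono) auto
    then show "norm (1 / (of_real x - z) ^ n) \<le> 1 / Im z ^ n"
      using assms by (auto simp: norm_divide norm_power intro!: divide_left_mono)
        (metis zero_less_power mult_pos_pos order_less_le_trans)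
  qed
qed measurable

text \<open>The error of the difference quotient is a single integral, whose integrand is at most a
  constant times |w - z|.\<close>

lemma (in real_distribution) stieltjes_transform_has_field_derivative:
  assumes "Im z > 0"
  shows "(stieltjes_transform M has_field_derivative (LINT x|M. 1 / (of_real x - z) ^ 2)) (at z)"
proof -
  define d where "d = Im z"
  let ?D = "LINT x|M. 1 / (complex_of_real x - z) ^ 2"
  \<comment> \<open>For Im w > d/2 one has |x - w| \<ge> d/2 and |x - z| \<ge> d, hence |x - w| |x -
    z|^2 \<ge> d^3/2.\<close>
  let ?C = "2 / d ^ 3"
  have d: "d > 0" using assms by (simp add: d_def)
  have bound: "norm ((stieltjes_transform M w - stieltjes_transform M z) / (w - z) - ?D)
      \<le> norm (w - z) * ?C" if w: "w \<noteq> z" "Im w > d / 2" for w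
  proof -
    have pos: "Im w > 0" "Im z > 0" using w d by (auto simp: d_def)
    have ne: "of_real x - w \<noteq> 0" "of_real x - z \<noteq> 0" for x
      using pos by (auto simp: complex_eq_iff)
    note int = integrable_resolvent_power[OF pos(1), of 1, simplified]
      integrable_resolvent_power[OF pos(2), of 1, simplified]
      integrable_resolvent_power[OF pos(2), of 2]
    let ?f = "\<lambda>x. (1 / (of_real x - w) - 1 / (of_real x - z)) / (w - z) - 1 / (of_real x - z) ^ 2"
    have f_int: "integrable M ?f" using int by auto
    have eq: "(stieltjes_transform M w - stieltjes_transform M z) / (w - z) - ?D = (LINT x|M. ?f x)"
      unfolding stieltjes_transform_def using int by simp
    have "norm (LINT x|M. ?f x) \<le> (LINT x|M. norm (w - z) * ?C)"
    proof (rule Bochner_Integration.integral_norm_bound_integral[OF f_int])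
      fix x
      \<comment> \<open>To be used with a = x - w and b = x - z, so that b - a = w - z.\<close>
      have "(1 / a - 1 / b) / (b - a) - 1 / b ^ 2 = (b - a) / (a * b ^ 2)"
        if "a \<noteq> 0" "b \<noteq> 0" "b - a \<noteq> 0" for a b :: complex
        using that by (simp add: divide_simps) (simp add: algebra_simps power2_eq_square)
      from this[of "of_real x - w" "of_real x - z"]
      have "?f x = (w - z) / ((of_real x - w) * (of_real x - z) ^ 2)"
        using ne[of x] w by simp
      then have "norm (?f x) = norm (w - z) / (norm (of_real x - w) * norm (of_real x - z) ^ 2)"
        by (simp only: norm_divide norm_mult norm_power)
      also have "\<dots> \<le> norm (w - z) / (d / 2 * d ^ 2)"
      proof (rule divide_left_mono)
        show "d / 2 * d ^ 2 \<le> norm (of_real x - w) * norm (of_real x - z) ^ 2"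
          using Im_le_norm_of_real_diff[of w x] Im_le_norm_of_real_diff[of z x] w d
          by (intro mult_mono power_mono) (auto simp: d_def)
      qed (use ne[of x] d in auto)
      also have "\<dots> = norm (w - z) * ?C"
        by (simp add: power2_eq_square power3_eq_cube)
      finally show "norm (?f x) \<le> norm (w - z) * ?C" .
    qed simp
    then show ?thesis unfolding eq using prob_space by simp
  qed
  have "eventually (\<lambda>w. w \<noteq> z \<and> Im w > d / 2) (at z)"
  proof (intro eventually_conj)
    have "open {w. Im w > d / 2}" by (rule open_halfspace_Im_gt)
    then show "eventually (\<lambda>w. Im w > d / 2) (at z)"
      using eventually_at_in_open'[of "{w. Im w > d / 2}" z] d by (simp add: d_def)
  qed (simp add: eventually_at_filter)
  then have ev: "eventually (\<lambda>w. norm ((stieltjes_transform M w - stieltjes_transform M z) / (w - z) - ?D)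
      \<le> norm (w - z) * ?C) (at z)"
    by eventually_elim (use bound in blast)
  have "((\<lambda>w. norm (w - z) * ?C) \<longlongrightarrow> norm (z - z) * ?C) (at z)"
    by (intro tendsto_intros)
  then have "((\<lambda>w. norm (w - z) * ?C) \<longlongrightarrow> 0) (at z)"
    by simp
  from Lim_null_comparison[OF ev this]
  show ?thesis
    unfolding has_field_derivative_iff using LIM_zero_iff by blast
qed

lemma (in real_distribution) holomorphic_on_stieltjes_transform:
  "stieltjes_transform M holomorphic_on {z. Im z > 0}"
  using stieltjes_transform_has_field_derivative
  by (auto simp: holomorphic_on_open open_halfspace_Im_gt)

lemma holomorphic_on_eval_bipoly:
  assumes "f holomorphic_on S"
  shows "(\<lambda>z. eval_bipoly L (f z) z) holomorphic_on S"
proof -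
  obtain k where "\<And>i. degree (coeff L i) \<le> k" using bounded_degree_coeffs by blast
  then show ?thesis
    by (subst eval_bipoly_sum[of L "degree L" k]) (auto intro!: holomorphic_intros assms)
qed

section \<open>Free additive convolution\<close>

lemma open_truncated_angle: "open (truncated_angle \<alpha> \<beta>)"
proof -
  have "truncated_angle \<alpha> \<beta> = {z. \<bar>Re z\<bar> < \<alpha> * Im z} \<inter> {z. \<beta> < Im z}"
    by (auto simp: truncated_angle_def)
  also have "open \<dots>"
    by (intro open_Int open_Collect_less continuous_intros)
  finally show ?thesis .
qed

lemma truncated_angle_nonempty:
  assumes "\<alpha> > 0"
  shows "truncated_angle \<alpha> \<beta> \<noteq> {}"
proof -
  have "Complex 0 (max \<beta> 0 + 1) \<in> truncated_angle \<alpha> \<beta>"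
    using assms by (auto simp: truncated_angle_def)
  then show ?thesis by blast
qed

text \<open>Inversion is an involution, so the image is a preimage under a map that is continuous
  off 0.\<close>

lemma open_inverse_image:
  fixes S :: "complex set"
  assumes "open S" "0 \<notin> S"
  shows "open (inverse ` S)"
proof -
  have "inverse ` S = - {0} \<inter> inverse -` S"
    using assms(2) by (auto simp: image_iff) (metis inverse_inverse_eq)
  also have "open \<dots>"
    using assms(1) by (intro continuous_open_preimage continuous_intros) auto
  finally show ?thesis .
qed

text \<open>Trades \<open>the_inv_into\<close> for a right inverse \<open>z\<close> of the Cauchy
  transform. Injectivity is passed on, to show for \<open>C\<close> that \<open>z\<close> is also a
  left inverse.\<close>

lemma is_R_transform_onE:
  assumes "is_R_transform_on D M r"
  obtains \<alpha> \<beta> z where "\<beta> > 0" "inj_on (cauchy_transform M) (truncated_angle \<alpha> \<beta>)"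
    and "\<And>g. g \<in> D \<Longrightarrow> z g \<in> truncated_angle \<alpha> \<beta>"
    and "\<And>g. g \<in> D \<Longrightarrow> cauchy_transform M (z g) = g"
    and "\<And>g. g \<in> D \<Longrightarrow> r g = z g - 1 / g"
proof -
  obtain \<alpha> \<beta> where *: "\<beta> > 0" "inj_on (cauchy_transform M) (truncated_angle \<alpha> \<beta>)"
      "D \<subseteq> cauchy_transform M ` truncated_angle \<alpha> \<beta>"
      "\<forall>g\<in>D. r g = the_inv_into (truncated_angle \<alpha> \<beta>) (cauchy_transform M) g - 1 / g"
    using assms unfolding is_R_transform_on_def by blast
  show ?thesis
  proof (rule that[OF *(1,2)])
    fix g assume "g \<in> D"
    with * show "the_inv_into (truncated_angle \<alpha> \<beta>) (cauchy_transform M) g \<in> truncated_angle \<alpha> \<beta>"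
      and "cauchy_transform M (the_inv_into (truncated_angle \<alpha> \<beta>) (cauchy_transform M) g) = g"
      and "r g = the_inv_into (truncated_angle \<alpha> \<beta>) (cauchy_transform M) g - 1 / g"
      by (auto intro: the_inv_into_into f_the_inv_into_f)
  qed
qed

text \<open>The value of the transform at \<open>z m\<close> is \<open>m\<close>, so L(m, z(m)) = 0;
  transposed, this is an equation for z(m) over \<real>[m].\<close>

lemma algebraic_on_inverse_stieltjes_transform:
  assumes "algebraic_distribution M" "infinite T"
    and z: "\<And>m. m \<in> T \<Longrightarrow> Im (z m) > 0" "\<And>m. m \<in> T \<Longrightarrow> stieltjes_transform M (z m) = m"
  shows "evaluations.algebraic_on T (\<lambda>m p. poly (map_poly complex_of_real p) m) z"
proof -
  interpret evaluations T "\<lambda>m p. poly (map_poly complex_of_real p) m"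
    by (rule evaluations_of_real_poly) fact
  obtain L where L: "L \<noteq> 0" "\<And>z. Im z > 0 \<Longrightarrow> eval_bipoly L (stieltjes_transform M z) z = 0"
    using assms(1) unfolding algebraic_distribution_def by blast
  from L(1) obtain K where "K \<noteq> 0" "\<And>m z. eval_bipoly K z m = eval_bipoly L m z"
    by (rule eval_bipoly_swap) blast
  then show ?thesis
    unfolding algebraic_on_def using L(2) z by (metis eval_bipoly_def)
qed

theorem corollary9p5:
  fixes A B C :: "real measure"
  assumes "algebraic_distribution A"
    and "algebraic_distribution B"
    and "is_free_additive_convolution A B C"
  shows "algebraic_distribution C"
proof -
  obtain a b r\<^sub>A r\<^sub>B where ab: "a > 0" "b > 0"
    and r\<^sub>A: "is_R_transform_on (inverse ` truncated_angle a b) A r\<^sub>A"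
    and r\<^sub>B: "is_R_transform_on (inverse ` truncated_angle a b) B r\<^sub>B"
    and r\<^sub>C: "is_R_transform_on (inverse ` truncated_angle a b) C (\<lambda>g. r\<^sub>A g + r\<^sub>B g)"
    and C: "real_distribution C"
    using assms(3) unfolding is_free_additive_convolution_def Let_def by blast
  interpret C: real_distribution C by fact
  define D where "D = inverse ` truncated_angle a b"
  have "0 \<notin> truncated_angle a b" using ab by (auto simp: truncated_angle_def)
  then have D: "open D" "D \<noteq> {}" "0 \<notin> D"
    using open_inverse_image open_truncated_angle truncated_angle_nonempty[OF ab(1)]
    by (auto simp: D_def image_iff)
  have pos: "Im z > 0" if "z \<in> truncated_angle \<alpha> \<beta>" "\<beta> > 0" for z \<alpha> \<beta>
    using that by (auto simp: truncated_angle_def)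
  obtain \<alpha>\<^sub>A \<beta>\<^sub>A z\<^sub>A where A: "\<beta>\<^sub>A > 0" "\<And>g. g \<in> D \<Longrightarrow> z\<^sub>A g \<in> truncated_angle \<alpha>\<^sub>A \<beta>\<^sub>A"
      "\<And>g. g \<in> D \<Longrightarrow> cauchy_transform A (z\<^sub>A g) = g" "\<And>g. g \<in> D \<Longrightarrow> r\<^sub>A g = z\<^sub>A g - 1 / g"
    using r\<^sub>A unfolding D_def[symmetric] by (rule is_R_transform_onE) blast
  obtain \<alpha>\<^sub>B \<beta>\<^sub>B z\<^sub>B where B: "\<beta>\<^sub>B > 0" "\<And>g. g \<in> D \<Longrightarrow> z\<^sub>B g \<in> truncated_angle \<alpha>\<^sub>B \<beta>\<^sub>B"
      "\<And>g. g \<in> D \<Longrightarrow> cauchy_transform B (z\<^sub>B g) = g" "\<And>g. g \<in> D \<Longrightarrow> r\<^sub>B g = z\<^sub>B g - 1 / g"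
    using r\<^sub>B unfolding D_def[symmetric] by (rule is_R_transform_onE) blast
  obtain \<alpha> \<beta> z\<^sub>C where \<beta>: "\<beta> > 0"
    and inj: "inj_on (cauchy_transform C) (truncated_angle \<alpha> \<beta>)"
    and z\<^sub>C: "\<And>g. g \<in> D \<Longrightarrow> z\<^sub>C g \<in> truncated_angle \<alpha> \<beta>"
      "\<And>g. g \<in> D \<Longrightarrow> cauchy_transform C (z\<^sub>C g) = g"
    and r_sum: "\<And>g. g \<in> D \<Longrightarrow> r\<^sub>A g + r\<^sub>B g = z\<^sub>C g - 1 / g"
    using r\<^sub>C unfolding D_def[symmetric] by (rule is_R_transform_onE) blast
  \<comment> \<open>The term -1/g occurs twice on the side of \<open>A\<close> and \<open>B\<close>
    and once on that of \<open>C\<close>, so one copy is left; it becomes +1/m for m = -g.\<close>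
  have z_sum: "z\<^sub>C g = z\<^sub>A g + z\<^sub>B g - 1 / g" if "g \<in> D" for g
  proof -
    have "z\<^sub>C g = r\<^sub>A g + r\<^sub>B g + 1 / g" using r_sum[OF that] by simp
    then show ?thesis unfolding A(4)[OF that] B(4)[OF that] by simp
  qed

  \<comment> \<open>The algebraic relations concern the Stieltjes transform m = -g, so the domain is
    reflected.\<close>
  define T where "T = uminus ` D"
  have T_D: "- m \<in> D" if "m \<in> T" for m using that by (auto simp: T_def)
  have "infinite D" using D(1,2) finite_imp_not_open by blast
  then have T: "infinite T" by (simp add: T_def finite_image_iff)
  interpret evaluations T "\<lambda>m p. poly (map_poly complex_of_real p) m"
    by (rule evaluations_of_real_poly) fact
  have "algebraic_on (\<lambda>m. z\<^sub>A (- m))"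
    by (rule algebraic_on_inverse_stieltjes_transform[OF assms(1) T])
      (use A(1,2,3) T_D pos in \<open>force simp: cauchy_transform_def minus_equation_iff\<close>)+
  moreover have "algebraic_on (\<lambda>m. z\<^sub>B (- m))"
    by (rule algebraic_on_inverse_stieltjes_transform[OF assms(2) T])
      (use B(1,2,3) T_D pos in \<open>force simp: cauchy_transform_def minus_equation_iff\<close>)+
  moreover have "algebraic_on (\<lambda>m. 1 / m)"
    unfolding algebraic_on_def
  \<comment> \<open>1/m is the root of m X - 1. Here 0 \<notin> D matters, as 1/0 is 0 by convention
    and no root.\<close>
  proof (intro exI[of _ "[:-1, [:0, 1:]:]"] conjI ballI)
    fix m assume "m \<in> T"
    then have "m \<noteq> 0" using T_D[of m] D(3) by auto
    then show "poly (map_poly (\<lambda>p. poly (map_poly complex_of_real p) m) [:-1, [:0, 1:]:]) (1 / m) = 0"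
      using \<open>m \<in> T\<close> h_minus[of m 1] by (simp add: map_poly_pCons)
  qed simp
  ultimately have "algebraic_on (\<lambda>m. z\<^sub>A (- m) + z\<^sub>B (- m) + 1 / m)"
    by (intro algebraic_on_add)
  then obtain K where K: "K \<noteq> 0" "\<And>m. m \<in> T \<Longrightarrow> eval_bipoly K (z\<^sub>A (- m) + z\<^sub>B (- m) + 1 / m) m = 0"
    unfolding algebraic_on_def eval_bipoly_def by blast
  \<comment> \<open>\<open>K\<close> is a polynomial in z over \<real>[m], whereas
    \<open>algebraic_distribution\<close> asks for one in m over \<real>[z].\<close>
  from K(1) obtain L where L: "L \<noteq> 0" "\<And>m z. eval_bipoly L m z = eval_bipoly K z m"
    by (rule eval_bipoly_swap) blast

  \<comment> \<open>On \<open>U\<close>, injectivity makes \<open>z\<^sub>C\<close> a left inverse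
    of the Cauchy transform as well, so the relation for \<open>z\<^sub>C\<close> holds at every
    point of \<open>U\<close>. The values of \<open>z\<^sub>C\<close> on \<open>D\<close> lie in
    \<open>U\<close>, so it is nonempty.\<close>
  define U where "U = truncated_angle \<alpha> \<beta> \<inter> cauchy_transform C -` D"
  have upper: "truncated_angle \<alpha> \<beta> \<subseteq> {z. Im z > 0}" using pos[OF _ \<beta>] by blast
  have "continuous_on (truncated_angle \<alpha> \<beta>) (cauchy_transform C)"
    unfolding cauchy_transform_def
    by (intro continuous_on_minus holomorphic_on_imp_continuous_on
        holomorphic_on_subset[OF C.holomorphic_on_stieltjes_transform upper])
  then have "open U"
    unfolding U_def using open_truncated_angle D(1) by (rule continuous_open_preimage)
  moreover have "U \<noteq> {}" using D(2) z\<^sub>C by (auto simp: U_def)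
  moreover have "eval_bipoly L (stieltjes_transform C z) z = 0" if "z \<in> U" for z
  proof -
    define g where "g = cauchy_transform C z"
    have g: "g \<in> D" using that by (simp add: U_def g_def)
    have "z\<^sub>C g = z"
      using inj_onD[OF inj, of "z\<^sub>C g" z] z\<^sub>C[OF g] that by (simp add: U_def g_def)
    then have "eval_bipoly K z (- g) = 0"
      using K(2)[of "- g"] g z_sum[OF g] by (simp add: T_def)
    then show ?thesis by (simp add: L(2) g_def cauchy_transform_def)
  qed
  \<comment> \<open>Identity theorem: the left side is holomorphic on the connected half plane and
    vanishes on the nonempty open set \<open>U\<close>.\<close>
  ultimately have "eval_bipoly L (stieltjes_transform C z) z = 0" if "Im z > 0" for z
    using analytic_continuation_open[of U "{z. Im z > 0}"
        "\<lambda>z. eval_bipoly L (stieltjes_transform C z) z" "\<lambda>_. 0" z] upper that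
      holomorphic_on_eval_bipoly[OF C.holomorphic_on_stieltjes_transform]
    by (auto simp: U_def open_halfspace_Im_gt convex_halfspace_Im_gt intro: convex_connected)
  then show ?thesis
    unfolding algebraic_distribution_def using C L(1) by blast
qed

end
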